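(* For $b<0$ let $E_I(\cdot,\cdot;0,b)$ be the function on $\mathbb R^2$ given in the context. As $b\to 0^-$, $E_I(\cdot,\cdot;0,b)$ converges in the sense of distributions on $\mathbb R^2$ to the function $$F_-(x,y)=\begin{cases}C_-\,|9x^2+4y^3|^{-1/6}&\text{if }9x^2+4y^3<0,\\ 0&\text{elsewhere,}\end{cases}\qquad C_-=\frac{1}{2^{1/3}}\,F\!\left(\tfrac16,\tfrac16;1;1\right)=\frac{1}{2^{1/3}}\frac{\Gamma(2/3)}{\Gamma(5/6)^2}.$$ That is, $\iint E_I(x,y;0,b)\varphi(x,y)\,dx\,dy\to\iint F_-(x,y)\varphi(x,y)\,dx\,dy$ for every $\varphi\in C_c^\infty(\mathbb R^2)$.
   Context: $F(\alpha,\beta;\gamma;\zeta)$ is the Gauss hypergeometric function. For $y\le 0$ put $\ell=3x+2(-y)^{3/2}$, $m=3x-2(-y)^{3/2}$, and for $b<0$ put $\ell_0=2(-b)^{3/2}$. Let $D_I=\{(x,y):\ y<0,\ \ell>\ell_0,\ m<-\ell_0\}$. Define $$E_I(x,y;0,b)=2^{-1/3}(\ell+\ell_0)^{-1/6}(\ell_0-m)^{-1/6}\,F\!\left(\tfrac16,\tfrac16;1;\frac{(\ell-\ell_0)(m+\ell_0)}{(\ell+\ell_0)(m-\ell_0)}\right)\quad\text{for }(x,y)\in D_I,$$ and $E_I(x,y;0,b)=0$ elsewhere. ($E_I$ is a fundamental solution of the Tricomi operator $y\,\partial_x^2+\partial_y^2$ relative to $(0,b)$, and $F_-$ is one relative to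 $(0,0)$.) *)

theory Defs
  imports "HOL-Analysis.Analysis"
begin

text \<open>The Gauss hypergeometric function \<open>F(a,b;c;z)\<close> as the sum of its power series. It is used
  here only for \<open>0 \<le> z \<le> 1\<close>; at \<open>z = 1\<close> the series still converges when \<open>c - a - b > 0\<close>.\<close>

definition gauss_F :: "real \<Rightarrow> real \<Rightarrow> real \<Rightarrow> real \<Rightarrow> real" where
  "gauss_F a b c z = eval_fps (fps_hypergeo [a, b] [c] 1) z"

lemma gauss_F_series:
  "gauss_F a b c z =
     (\<Sum>n. pochhammer a n * pochhammer b n / (pochhammer c n * fact n) * z ^ n)"
  by (simp add: gauss_F_def eval_fps_def)

definition ell :: "real \<Rightarrow> real \<Rightarrow> real" where
  "ell x y = 3 * x + 2 * (- y) powr (3/2)"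

definition em :: "real \<Rightarrow> real \<Rightarrow> real" where
  "em x y = 3 * x - 2 * (- y) powr (3/2)"

definition ell0 :: "real \<Rightarrow> real" where
  "ell0 b = 2 * (- b) powr (3/2)"

definition D_I :: "real \<Rightarrow> (real \<times> real) set" where
  "D_I b = {(x, y). y < 0 \<and> ell x y > ell0 b \<and> em x y < - ell0 b}"

text \<open>\<open>E_I b (x, y)\<close> is \<open>E\<^sub>I(x, y; 0, b)\<close>, with pole at the point \<open>(0, b)\<close>.\<close>

definition E_I :: "real \<Rightarrow> real \<times> real \<Rightarrow> real" where
  "E_I b = (\<lambda>(x, y).
     if (x, y) \<in> D_I b then
       2 powr (-1/3) * (ell x y + ell0 b) powr (-1/6) * (ell0 b - em x y) powr (-1/6) *
       gauss_F (1/6) (1/6) 1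
         (((ell x y - ell0 b) * (em x y + ell0 b)) / ((ell x y + ell0 b) * (em x y - ell0 b)))
     else 0)"

definition C_minus :: real where
  "C_minus = 1 / 2 powr (1/3) * gauss_F (1/6) (1/6) 1 1"

definition F_minus :: "real \<times> real \<Rightarrow> real" where
  "F_minus = (\<lambda>(x, y).
     if 9 * x^2 + 4 * y^3 < 0 then C_minus * \<bar>9 * x^2 + 4 * y^3\<bar> powr (-1/6) else 0)"

text \<open>\<open>C\<^sup>k\<close> functions on the whole space; the class \<open>C\<^sup>0\<close> is continuity, and each further step asks
  for Frechet differentiability with all directional derivatives in the preceding class.\<close>

primrec C_k :: "nat \<Rightarrow> ('a::euclidean_space \<Rightarrow> 'b::real_normed_vector) \<Rightarrow> bool" where
  "C_k 0 f \<longleftrightarrow> continuous_on UNIV f"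
| "C_k (Suc k) f \<longleftrightarrow>
     (\<forall>x. f differentiable (at x)) \<and> (\<forall>v. C_k k (\<lambda>x. frechet_derivative f (at x) v))"

definition test_function :: "('a::euclidean_space \<Rightarrow> complex) \<Rightarrow> bool" where
  "test_function \<phi> \<longleftrightarrow> (\<forall>k. C_k k \<phi>) \<and> compact (closure {x. \<phi> x \<noteq> 0})"

definition locally_integrable :: "('a::euclidean_space \<Rightarrow> real) \<Rightarrow> bool" where
  "locally_integrable f \<longleftrightarrow> (\<forall>K. compact K \<longrightarrow> set_integrable lborel K f)"

text \<open>Convergence in the sense of distributions of a family of functions. Local integrability is
  what makes the functions distributions; it also ensures that the integrals below are genuine,
  as the library's integral of a non-integrable function is \<open>0\<close>.\<close>

definition converges_distributionally ::
    "('b \<Rightarrow> 'a::euclidean_space \<Rightarrow> real) \<Rightarrow> ('a \<Rightarrow> real) \<Rightarrow> 'b filter \<Rightarrow> bool" where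
  "converges_distributionally f g L \<longleftrightarrow>
     (\<forall>\<^sub>F b in L. locally_integrable (f b)) \<and> locally_integrable g \<and>
     (\<forall>\<phi>. test_function \<phi> \<longrightarrow>
       ((\<lambda>b. LINT p|lborel. complex_of_real (f b p) * \<phi> p) \<longlongrightarrow>
          (LINT p|lborel. complex_of_real (g p) * \<phi> p)) L)"

end

theory Submission
  imports Defs "HOL-Real_Asymp.Real_Asymp"
begin

text \<open>With \<open>l = ell x y\<close>, \<open>m = em x y\<close> and \<open>l0 = ell0 b\<close> one has \<open>l * m = 9x\<^sup>2 + 4y\<^sup>3\<close> for
  \<open>y < 0\<close>, and \<open>F_minus\<close> is positive exactly on the region \<open>y < 0\<close>, \<open>m < 0 < l\<close>. The regions \<open>D_I b\<close> lie inside it and exhaust it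
  as \<open>l0\<close> decreases to \<open>0\<close>. On \<open>D_I b\<close> the argument of the hypergeometric function is the product of
  \<open>(l - l0)/(l + l0)\<close> and \<open>(-m - l0)/(-m + l0)\<close>. It lies in \<open>[0,1]\<close> and tends to \<open>1\<close> at each fixed
  point of the larger region.

  The Taylor coefficients of \<open>F(1/6,1/6;1;\<cdot>)\<close> are positive and summable. So this function is
  continuous up to \<open>1\<close> and takes its maximum over \<open>[0,1]\<close> there, whence \<open>E_I b\<close> tends to \<open>F_minus\<close>
  pointwise (\<open>E_I_tendsto_F_minus\<close>). Moreover \<open>(l + l0)(l0 - m) \<ge> l (-m)\<close>, and the exponent \<open>-1/6\<close>
  reverses this inequality, so \<open>0 \<le> E_I b \<le> F_minus\<close> everywhere (\<open>E_I_bounds\<close>). The limit function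
  is thus itself a majorant of the whole family. As it is locally integrable
  (\<open>locally_integrable_F_minus\<close>), dominated convergence gives the distributional limit.

  The value of the constant is Gauss's formula for \<open>F(a,b;c;1)\<close> (\<open>gauss_summation\<close>): a contiguous
  relation moves \<open>c\<close> to \<open>c + n\<close>, where the series tends to \<open>1\<close>, and the accumulated factors converge
  to a quotient of Gamma values.\<close>

section \<open>Gauss's summation formula\<close>

definition gauss_coeff :: "real \<Rightarrow> real \<Rightarrow> real \<Rightarrow> nat \<Rightarrow> real" where
  "gauss_coeff a b c n = pochhammer a n * pochhammer b n / (pochhammer c n * fact n)"

lemma gauss_F_altdef: "gauss_F a b c z = (\<Sum>n. gauss_coeff a b c n * z ^ n)"
  by (simp add: gauss_F_series gauss_coeff_def)

lemma gauss_coeff_0 [simp]: "gauss_coeff a b c 0 = 1"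
  by (simp add: gauss_coeff_def)

lemma gauss_coeff_pos:
  assumes "a > 0" "b > 0" "c > 0"
  shows "gauss_coeff a b c n > 0"
  using assms by (simp add: gauss_coeff_def pochhammer_pos)

lemma gauss_coeff_Suc:
  "gauss_coeff a b c (Suc n) =
    gauss_coeff a b c n * ((a + n) * (b + n)) / ((c + n) * (1 + n))"
  by (simp add: gauss_coeff_def pochhammer_Suc mult_ac)

lemma gauss_coeff_shift:
  assumes "c > 0"
  shows "gauss_coeff a b (c + 1) n = gauss_coeff a b c n * c / (c + n)"
proof -
  have "c * pochhammer (c + 1) n = pochhammer c n * (c + n)"
    using pochhammer_rec[of c n] pochhammer_Suc[of c n] by simp
  moreover have "pochhammer c n > 0" "pochhammer (c + 1) n > 0"
    using assms by (simp_all add: pochhammer_pos)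
  ultimately show ?thesis
    using assms by (simp add: gauss_coeff_def divide_simps mult_ac)
qed

text \<open>The coefficients decay like \<open>n\<close> to the power \<open>a + b - c - 1\<close>; the quotient of successive
  coefficients shows this exponent to Raabe's test.\<close>

lemma summable_gauss_coeff:
  assumes "a > 0" "b > 0" "c > a + b"
  shows "summable (gauss_coeff a b c)"
proof (rule raabes_test_convergence)
  let ?A = "gauss_coeff a b c"
  have pos: "?A n > 0" for n
    using assms by (intro gauss_coeff_pos) auto
  show "eventually (\<lambda>n. ?A n > 0) sequentially"
    using pos by simp
  have "?A n / ?A (Suc n) = (c + n) * (1 + n) / ((a + n) * (b + n))" for n
    using pos[of n] assms by (simp add: gauss_coeff_Suc)
  moreover have "(\<lambda>n. real n * ((c + real n) * (1 + real n) / ((a + real n) * (b + real n)) - 1))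
      \<longlonglongrightarrow> c + 1 - a - b"
    by real_asymp
  ultimately have "(\<lambda>n. real n * (?A n / ?A (Suc n) - 1)) \<longlonglongrightarrow> c + 1 - a - b"
    by simp
  then have "(\<lambda>n. ereal (real n * (?A n / ?A (Suc n) - 1))) \<longlonglongrightarrow> ereal (c + 1 - a - b)"
    by simp
  then have "liminf (\<lambda>n. ereal (real n * (?A n / ?A (Suc n) - 1))) = ereal (c + 1 - a - b)"
    by (intro lim_imp_Liminf) auto
  then show "liminf (\<lambda>n. ereal (real n * (?A n / ?A (Suc n) - 1))) > 1"
    using assms by simp
qed

text \<open>The coefficients for \<open>c\<close> and \<open>c + 1\<close>, weighted as in the contiguous relation at \<open>z = 1\<close>, differ by
  a discrete derivative. Dividing by \<open>c * gauss_coeff a b c n / (c + n)\<close> reduces the claim to the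
  identity \<open>(c - a)(c - b) - (c - a - b)(c + n) = (a + n)(b + n) - n (c + n)\<close>.\<close>

lemma gauss_coeff_contiguous:
  assumes "c > 0"
  shows "(c - a) * (c - b) * gauss_coeff a b (c + 1) n - c * (c - a - b) * gauss_coeff a b c n
    = c * (Suc n * gauss_coeff a b c (Suc n) - n * gauss_coeff a b c n)"
proof -
  have nz: "c + n \<noteq> 0" "1 + real n \<noteq> 0"
    using assms by linarith+
  have "(c - a) * (c - b) * gauss_coeff a b (c + 1) n - c * (c - a - b) * gauss_coeff a b c n
     = c * gauss_coeff a b c n * (((c - a) * (c - b) - (c - a - b) * (c + n)) / (c + n))"
    using nz assms by (simp add: gauss_coeff_shift divide_simps) algebra
  moreover have "c * (Suc n * gauss_coeff a b c (Suc n) - n * gauss_coeff a b c n)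
     = c * gauss_coeff a b c n * (((a + n) * (b + n) - n * (c + n)) / (c + n))"
    using nz assms by (simp add: gauss_coeff_Suc divide_simps) algebra
  moreover have "(c - a) * (c - b) - (c - a - b) * (c + n) = (a + n) * (b + n) - n * (c + n)"
    by (simp add: algebra_simps)
  ultimately show ?thesis by simp
qed

text \<open>Summing the previous identity leaves only the limit of \<open>c * N * gauss_coeff a b c N\<close>. It exists
  because both series converge, and it vanishes because otherwise the summable coefficients would
  dominate a multiple of the harmonic series.\<close>

lemma gauss_F_contiguous:
  assumes "a > 0" "b > 0" "c > a + b"
  shows "c * (c - a - b) * gauss_F a b c 1 = (c - a) * (c - b) * gauss_F a b (c + 1) 1"
proof -
  let ?A = "gauss_coeff a b c" and ?B = "gauss_coeff a b (c + 1)"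
  have c: "c > 0" using assms by simp
  have sA: "summable ?A" and sB: "summable ?B"
    using assms by (auto intro!: summable_gauss_coeff)
  let ?D = "\<lambda>n. (c - a) * (c - b) * ?B n - c * (c - a - b) * ?A n"
  define S where "S = (c - a) * (c - b) * suminf ?B - c * (c - a - b) * suminf ?A"
  have "?D sums S"
    unfolding S_def using sA sB by (intro sums_diff sums_mult summable_sums)
  moreover have "(\<Sum>n<N. ?D n) = c * (N * ?A N)" for N
    using gauss_coeff_contiguous[OF c, of a b]
    by (induction N) (simp_all add: algebra_simps)
  ultimately have "(\<lambda>N. c * (N * ?A N)) \<longlonglongrightarrow> S"
    by (simp add: sums_def)
  then have lim: "(\<lambda>N. N * ?A N) \<longlonglongrightarrow> S / c"
    using c tendsto_divide[of "\<lambda>N. c * (N * ?A N)" S sequentially "\<lambda>_. c" c] by simp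
  have pos: "?A n > 0" for n
    using assms by (intro gauss_coeff_pos) auto
  have "S / c \<ge> 0"
    using lim by (rule LIMSEQ_le_const) (use pos in \<open>auto simp: less_imp_le\<close>)
  moreover have "\<not> S / c > 0"
  proof
    assume S: "S / c > 0"
    then have "eventually (\<lambda>N. N * ?A N > S / c / 2) sequentially"
      using lim by (intro order_tendstoD(1)[OF lim]) simp
    then have "eventually (\<lambda>N. norm (S / c / 2 * (1 / real N)) \<le> ?A N) sequentially"
      using eventually_gt_at_top[of 0]
    proof eventually_elim
      case (elim N)
      then show ?case using S c by (simp add: divide_simps mult_ac)
    qed
    then have "summable (\<lambda>N. S / c / 2 * (1 / real N))"
      using sA by (rule summable_comparison_test_ev)
    then have "summable (\<lambda>N. 1 / real N)"
      using S by (subst (asm) summable_cmult_iff) auto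
    then have "summable (\<lambda>N. inverse (real (Suc N)))"
      by (subst (asm) summable_Suc_iff[symmetric]) (simp add: inverse_eq_divide)
    then show False
      using not_summable_harmonic[where 'a=real] by (subst (asm) summable_Suc_iff) simp
  qed
  ultimately have "S = 0" using c by simp
  then show ?thesis
    by (simp add: S_def gauss_F_altdef)
qed

lemma gauss_F_1_iterate:
  assumes "a > 0" "b > 0" "c > a + b"
  shows "pochhammer c n * pochhammer (c - a - b) n * gauss_F a b c 1
    = pochhammer (c - a) n * pochhammer (c - b) n * gauss_F a b (c + n) 1"
proof (induction n)
  case (Suc n)
  have "(c + n) * (c + n - a - b) * gauss_F a b (c + n) 1
      = (c + n - a) * (c + n - b) * gauss_F a b (c + n + 1) 1"
    using assms by (intro gauss_F_contiguous) auto
  with Suc show ?case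
    by (simp add: pochhammer_Suc algebra_simps) algebra
qed simp

text \<open>In each term after the constant one, passing from \<open>c\<close> to \<open>c + n\<close> gains at least the factor
  \<open>c / (c + n)\<close>, already from the first factor of the Pochhammer symbol in the denominator.\<close>

lemma gauss_F_1_tendsto_1:
  assumes "a > 0" "b > 0" "c > a + b"
  shows "(\<lambda>n. gauss_F a b (c + real n) 1) \<longlonglongrightarrow> 1"
proof (rule tendsto_sandwich)
  let ?A = "\<lambda>n. gauss_coeff a b (c + real n)"
  define M where "M = (\<Sum>k. ?A 0 (Suc k))"
  have summ: "summable (?A n)" for n
    using assms by (intro summable_gauss_coeff) auto
  have pos: "?A n k > 0" for n k
    using assms by (intro gauss_coeff_pos) auto
  have eq: "gauss_F a b (c + n) 1 = 1 + (\<Sum>k. ?A n (Suc k))" for n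
    using suminf_split_head[OF summ[of n]] by (simp add: gauss_F_altdef)
  have le: "?A n (Suc k) \<le> c / (c + n) * ?A 0 (Suc k)" for n k
  proof -
    have "(c + n) * pochhammer c (Suc k) \<le> c * pochhammer (c + n) (Suc k)"
    proof -
      have "pochhammer (c + 1) k \<le> pochhammer (c + n + 1) k"
        using assms unfolding pochhammer_prod by (intro prod_mono) auto
      then show ?thesis
        using assms by (simp add: pochhammer_rec mult_ac mult_left_mono)
    qed
    moreover have "pochhammer c (Suc k) > 0" "pochhammer (c + n) (Suc k) > 0" "c > 0"
      using assms by (auto intro!: pochhammer_pos)
    ultimately have "1 / pochhammer (c + n) (Suc k) \<le> c / (c + n) * (1 / pochhammer c (Suc k))"
      using assms by (simp add: divide_simps mult_ac del: pochhammer_Suc)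
    moreover have "pochhammer a (Suc k) * pochhammer b (Suc k) / fact (Suc k) \<ge> 0"
      using assms by (intro divide_nonneg_pos mult_nonneg_nonneg pochhammer_nonneg) auto
    ultimately have "pochhammer a (Suc k) * pochhammer b (Suc k) / fact (Suc k) * (1 / pochhammer (c + n) (Suc k)) \<le>
       pochhammer a (Suc k) * pochhammer b (Suc k) / fact (Suc k) * (c / (c + n) * (1 / pochhammer c (Suc k)))"
      by (rule mult_left_mono)
    then show ?thesis
      by (simp add: gauss_coeff_def mult_ac del: fact_Suc)
  qed
  have summ': "summable (\<lambda>k. ?A n (Suc k))" for n
    using summ by (subst summable_Suc_iff)
  show "\<forall>\<^sub>F n in sequentially. 1 \<le> gauss_F a b (c + real n) 1"
    using eq suminf_nonneg[OF summ'] pos by (simp add: less_imp_le)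
  show "\<forall>\<^sub>F n in sequentially. gauss_F a b (c + real n) 1 \<le> 1 + c / (c + real n) * M"
  proof (rule always_eventually, rule allI)
    fix n
    have "(\<Sum>k. ?A n (Suc k)) \<le> (\<Sum>k. c / (c + n) * ?A 0 (Suc k))"
      using le summ' by (intro suminf_le summable_mult)
    also have "\<dots> = c / (c + n) * M"
      unfolding M_def using summ'[of 0] by (rule suminf_mult)
    finally show "gauss_F a b (c + real n) 1 \<le> 1 + c / (c + real n) * M"
      by (simp add: eq)
  qed
  show "(\<lambda>n. 1 + c / (c + real n) * M) \<longlonglongrightarrow> 1"
    by real_asymp
qed simp_all

text \<open>After \<open>n + 1\<close> steps the accumulated factors are quotients of Pochhammer symbols, which are the
  numerators in \<open>rGamma_series\<close>. Its remaining factors cancel, since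
  \<open>c + (c - a - b) = (c - a) + (c - b)\<close>.\<close>

theorem gauss_summation:
  assumes "a > 0" "b > 0" "c > a + b"
  shows "gauss_F a b c 1 = Gamma c * Gamma (c - a - b) / (Gamma (c - a) * Gamma (c - b))"
proof -
  let ?r = "rGamma_series :: real \<Rightarrow> nat \<Rightarrow> real"
  have eq: "?r c n * ?r (c - a - b) n * gauss_F a b c 1
      = ?r (c - a) n * ?r (c - b) n * gauss_F a b (c + Suc n) 1" for n
  proof -
    let ?q = "fact n * fact n * exp ((2 * c - a - b) * ln (real n))"
    have "?r x n * ?r y n = pochhammer x (Suc n) * pochhammer y (Suc n) / ?q"
      if "x + y = 2 * c - a - b" for x y
      by (simp add: rGamma_series_def flip: that) (simp add: exp_add algebra_simps)
    then show ?thesis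
      using gauss_F_1_iterate[OF assms, of "Suc n"] by simp
  qed
  have "(\<lambda>n. gauss_F a b (c + Suc n) 1) \<longlonglongrightarrow> 1"
    using gauss_F_1_tendsto_1[OF assms] by (rule LIMSEQ_Suc)
  then have "(\<lambda>n. ?r (c - a) n * ?r (c - b) n * gauss_F a b (c + Suc n) 1)
      \<longlonglongrightarrow> rGamma (c - a) * rGamma (c - b) * 1"
    by (intro tendsto_intros)
  moreover have "(\<lambda>n. ?r c n * ?r (c - a - b) n * gauss_F a b c 1)
      \<longlonglongrightarrow> rGamma c * rGamma (c - a - b) * gauss_F a b c 1"
    by (intro tendsto_intros)
  ultimately have "rGamma c * rGamma (c - a - b) * gauss_F a b c 1 = rGamma (c - a) * rGamma (c - b)"
    unfolding eq by (simp add: LIMSEQ_unique)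
  moreover have "Gamma c > 0" "Gamma (c - a - b) > 0"
    using assms by (auto intro!: Gamma_real_pos)
  ultimately show ?thesis
    by (simp add: rGamma_inverse_Gamma field_simps)
qed

section \<open>The hypergeometric function on the closed unit interval\<close>

lemma gauss_F_bounds:
  assumes "a > 0" "b > 0" "c > a + b" "0 \<le> z" "z \<le> 1"
  shows "0 \<le> gauss_F a b c z" "gauss_F a b c z \<le> gauss_F a b c 1"
proof -
  let ?A = "gauss_coeff a b c"
  have pos: "?A n \<ge> 0" for n
    using assms by (intro less_imp_le gauss_coeff_pos) auto
  have le: "?A n * z ^ n \<le> ?A n" for n
    using pos[of n] assms by (intro mult_right_le_one_le) (auto intro: power_le_one)
  have summ: "summable ?A"
    using assms by (intro summable_gauss_coeff)
  have summ': "summable (\<lambda>n. ?A n * z ^ n)"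
    using summ by (rule summable_comparison_test') (use le pos assms in \<open>auto simp: abs_mult\<close>)
  show "0 \<le> gauss_F a b c z"
    unfolding gauss_F_altdef using pos assms by (intro suminf_nonneg summ') auto
  show "gauss_F a b c z \<le> gauss_F a b c 1"
    unfolding gauss_F_altdef using le summ summ' by (intro suminf_le) auto
qed

lemma continuous_on_gauss_F:
  assumes "a > 0" "b > 0" "c > a + b"
  shows "continuous_on {0..1} (gauss_F a b c)"
proof -
  let ?A = "gauss_coeff a b c"
  have pos: "?A n \<ge> 0" for n
    using assms by (intro less_imp_le gauss_coeff_pos) auto
  have "uniform_limit {0..1} (\<lambda>N z. \<Sum>n<N. ?A n * z ^ n) (\<lambda>z. \<Sum>n. ?A n * z ^ n) sequentially"
  proof (rule Weierstrass_m_test)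
    show "norm (?A n * z ^ n) \<le> ?A n" if "z \<in> {0..1}" for n z
      using that pos[of n] mult_left_le[of "z ^ n" "?A n"] by (simp add: abs_mult power_le_one)
    show "summable ?A"
      using assms by (intro summable_gauss_coeff)
  qed
  then have "continuous_on {0..1} (\<lambda>z. \<Sum>n. ?A n * z ^ n)"
    by (rule uniform_limit_theorem[rotated])
       (auto intro!: always_eventually continuous_intros)
  then show ?thesis
    by (simp add: gauss_F_altdef[abs_def])
qed

lemma borel_measurable_gauss_F [measurable]: "gauss_F a b c \<in> borel_measurable borel"
  unfolding gauss_F_altdef[abs_def] by measurable

section \<open>Characteristic coordinates\<close>

lemma ell_em:
  assumes "y < 0"
  shows "ell x y * em x y = 9 * x^2 + 4 * y^3"
proof -
  have "((- y) powr (3/2))\<^sup>2 = (- y) powr 3"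
    by (simp add: power2_eq_square flip: powr_add)
  also have "\<dots> = - (y ^ 3)"
    using assms by (simp add: powr_numeral power3_eq_cube)
  finally show ?thesis
    by (simp add: ell_def em_def power2_eq_square algebra_simps)
qed

text \<open>For \<open>y < 0\<close> always \<open>em x y < ell x y\<close>, so the product of the two is negative in exactly one way.\<close>

lemma hyperbolic_region:
  "9 * x^2 + 4 * y^3 < 0 \<longleftrightarrow> y < 0 \<and> ell x y > 0 \<and> em x y < 0"
proof (cases "y < 0")
  case True
  have "em x y < ell x y"
    using True by (simp add: ell_def em_def)
  with True show ?thesis
    by (auto simp: mult_less_0_iff simp flip: ell_em)
next
  case False
  then have "0 \<le> 4 * y^3" by simp
  then have "0 \<le> 9 * x^2 + 4 * y^3"
    by (intro add_nonneg_nonneg) simp_all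
  then have "\<not> 9 * x^2 + 4 * y^3 < 0" by (rule leD)
  with False show ?thesis by simp
qed

section \<open>Local integrability of the limit function\<close>

lemma nn_integral_inverse_sqrt:
  assumes "R \<ge> 0"
  shows "(\<integral>\<^sup>+t. ennreal (indicator {0..R} t * t powr (-1/2)) \<partial>lborel) = ennreal (2 * sqrt R)"
proof -
  have "((\<lambda>t. t powr (-1/2)) has_integral (R powr (-1/2 + 1) / (-1/2 + 1))) {0..R}"
    using assms by (intro has_integral_powr_from_0) auto
  then have "((\<lambda>t. t powr (-1/2)) has_integral (2 * sqrt R)) {0..R}"
    using assms by (simp add: powr_half_sqrt mult.commute)
  then show ?thesis
    by (intro nn_integral_has_integral_lebesgue) auto
qed

text \<open>On the vertical line through \<open>(x, 0)\<close> the function \<open>F_minus\<close> is nonzero exactly for \<open>- y > s0\<close>.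
  At distance \<open>d\<close> from the end point of this half-line, \<open>(s0 + d)\<^sup>3 - s0\<^sup>3 \<ge> d\<^sup>3\<close>. Since \<open>3 * (1/6) = 1/2\<close>, the singularity along this
  line is at worst an inverse square root. The bound is uniform in \<open>x\<close>, so it also covers the cusp
  \<open>x = 0\<close>, where \<open>s0 = 0\<close> and the order \<open>1/2\<close> is attained.\<close>

lemma cubic_bound:
  fixes x y s0 :: real
  assumes s0: "s0 \<ge> 0" "4 * s0 ^ 3 = 9 * x\<^sup>2" and neg: "9 * x\<^sup>2 + 4 * y ^ 3 < 0"
  shows "s0 < - y" and "\<bar>9 * x\<^sup>2 + 4 * y ^ 3\<bar> powr (-1/6) \<le> (- s0 - y) powr (-1/2)"
proof -
  have "s0 ^ 3 < (- y) ^ 3"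
    using neg s0 by (simp add: power3_eq_cube)
  then show less: "s0 < - y"
    by (rule power_less_imp_less_base) (use neg hyperbolic_region in auto)
  define d where "d = - s0 - y"
  have d: "d > 0" "- y = s0 + d"
    using less by (auto simp: d_def)
  have "d ^ 3 \<le> (s0 + d) ^ 3 - s0 ^ 3"
    using s0 d(1) by (simp add: power3_eq_cube algebra_simps)
  also have "\<dots> \<le> 4 * ((s0 + d) ^ 3 - s0 ^ 3)"
    using power_mono[of s0 "s0 + d" 3] s0(1) d(1) by simp
  also have "\<dots> = - (9 * x\<^sup>2 + 4 * y ^ 3)"
    unfolding d(2)[symmetric] using s0(2) by (simp add: right_diff_distrib)
  finally have "d ^ 3 \<le> \<bar>9 * x\<^sup>2 + 4 * y ^ 3\<bar>"
    using neg by simp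
  then have "\<bar>9 * x\<^sup>2 + 4 * y ^ 3\<bar> powr (-1/6) \<le> (d ^ 3) powr (-1/6)"
    using d by (intro powr_mono2') auto
  also have "(d ^ 3) powr (-1/6) = d powr (-1/2)"
    using d by (simp add: powr_powr flip: powr_numeral)
  finally show "\<bar>9 * x\<^sup>2 + 4 * y ^ 3\<bar> powr (-1/6) \<le> (- s0 - y) powr (-1/2)"
    by (simp add: d_def)
qed

lemma F_minus_measurable [measurable]: "F_minus \<in> borel_measurable borel"
  unfolding F_minus_def case_prod_beta borel_prod[symmetric] by measurable

lemma C_minus_nonneg: "C_minus \<ge> 0"
  using gauss_F_bounds(1)[of "1/6" "1/6" 1 1] by (simp add: C_minus_def)

lemma F_minus_nonneg: "F_minus p \<ge> 0"
  using C_minus_nonneg by (cases p) (simp add: F_minus_def)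

text \<open>Integrating first along the lines of constant \<open>x\<close>, the inner integral is bounded by the integral of
  an inverse square root over \<open>[0,R]\<close>, independently of \<open>x\<close>.\<close>

lemma nn_integral_F_minus_box:
  assumes "R \<ge> 0"
  shows "(\<integral>\<^sup>+p. ennreal (indicator ({-R..R} \<times> {-R..R}) p * F_minus p) \<partial>lborel)
     \<le> ennreal (2 * R) * ennreal (C_minus * (2 * sqrt R))"
proof -
  \<comment> \<open>The curve \<open>y = - s0 x\<close> is the boundary of the region \<open>9x\<^sup>2 + 4y\<^sup>3 < 0\<close>.\<close>
  define s0 where "s0 x = root 3 (9 * x\<^sup>2 / 4)" for x :: real
  have s0: "s0 x \<ge> 0" "4 * s0 x ^ 3 = 9 * x\<^sup>2" for x
    by (simp_all add: s0_def)
  define g where "g t = ennreal (indicator {0..R} t * t powr (-1/2))" for t :: real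
  have [measurable]: "g \<in> borel_measurable borel"
    unfolding g_def by measurable
  have [measurable]: "{-R..R} \<times> {-R..R} \<in> sets (borel :: (real \<times> real) measure)"
    by (intro borel_closed closed_Times closed_atLeastAtMost)
  have bound: "ennreal (indicator ({-R..R} \<times> {-R..R}) (x, y) * F_minus (x, y))
      \<le> indicator {-R..R} x * (ennreal C_minus * g (- s0 x + - 1 * y))" for x y
  proof (cases "9 * x\<^sup>2 + 4 * y ^ 3 < 0 \<and> x \<in> {-R..R} \<and> y \<in> {-R..R}")
    case True
    note cb = cubic_bound[OF s0, of x y]
    have "F_minus (x, y) \<le> C_minus * (- s0 x - y) powr (-1/2)"
      using True cb C_minus_nonneg by (auto simp: F_minus_def intro!: mult_left_mono)
    then have "ennreal (F_minus (x, y)) \<le> ennreal C_minus * ennreal ((- s0 x - y) powr (-1/2))"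
      using C_minus_nonneg by (simp add: ennreal_leI flip: ennreal_mult)
    moreover have "- s0 x - y \<in> {0..R}"
      using True cb s0(1)[of x] by auto
    ultimately show ?thesis
      using True by (simp add: g_def)
  next
    case False
    then show ?thesis
      by (auto simp: F_minus_def indicator_def)
  qed
  have "(\<integral>\<^sup>+p. ennreal (indicator ({-R..R} \<times> {-R..R}) p * F_minus p) \<partial>lborel)
     = (\<integral>\<^sup>+x. \<integral>\<^sup>+y. ennreal (indicator ({-R..R} \<times> {-R..R}) (x, y) * F_minus (x, y)) \<partial>lborel \<partial>lborel)"
    unfolding lborel_prod[symmetric]
    by (rule lborel.nn_integral_fst[symmetric]) (simp add: lborel_prod)
  also have "\<dots> \<le> (\<integral>\<^sup>+x. \<integral>\<^sup>+y. indicator {-R..R} x * (ennreal C_minus * g (- s0 x + - 1 * y)) \<partial>lborel \<partial>lborel)"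
    using bound by (intro nn_integral_mono) auto
  also have "\<dots> = (\<integral>\<^sup>+(x::real). indicator {-R..R} x * (ennreal C_minus * (\<integral>\<^sup>+y. g (- s0 x + - 1 * y) \<partial>lborel)) \<partial>lborel)"
    by (simp add: nn_integral_cmult)
  also have "(\<lambda>x. \<integral>\<^sup>+y. g (- s0 x + - 1 * y) \<partial>lborel) = (\<lambda>x. ennreal (2 * sqrt R))"
  proof
    fix x
    have "(\<integral>\<^sup>+y. g (- s0 x + - 1 * y) \<partial>lborel) = (\<integral>\<^sup>+t. g t \<partial>lborel)"
      using nn_integral_real_affine[of g "-1" "- s0 x"] by simp
    then show "(\<integral>\<^sup>+y. g (- s0 x + - 1 * y) \<partial>lborel) = ennreal (2 * sqrt R)"
      using nn_integral_inverse_sqrt[OF assms] by (simp add: g_def)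
  qed
  also have "(\<integral>\<^sup>+(x::real). indicator {-R..R} x * (ennreal C_minus * ennreal (2 * sqrt R)) \<partial>lborel)
      = ennreal (2 * R) * ennreal (C_minus * (2 * sqrt R))"
    using assms C_minus_nonneg
    by (simp add: nn_integral_multc ennreal_mult'')
  finally show ?thesis .
qed

lemma locally_integrable_F_minus: "locally_integrable F_minus"
  unfolding locally_integrable_def
proof (intro allI impI)
  fix K :: "(real \<times> real) set"
  assume K: "compact K"
  then obtain B where B: "\<And>p. p \<in> K \<Longrightarrow> norm p \<le> B"
    by (meson bounded_iff compact_imp_bounded)
  define R where "R = max B 0"
  have sub: "K \<subseteq> {-R..R} \<times> {-R..R}"
  proof
    fix p assume "p \<in> K"
    then have "norm p \<le> R" using B by (fastforce simp: R_def)
    then show "p \<in> {-R..R} \<times> {-R..R}"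
      using norm_fst_le[of "fst p" "snd p"] norm_snd_le[of "snd p" "fst p"]
      by (auto simp: mem_Times_iff abs_le_iff)
  qed
  have [measurable]: "K \<in> sets borel"
    using K by (simp add: borel_compact)
  have "(\<integral>\<^sup>+p. ennreal (norm (indicator K p *\<^sub>R F_minus p)) \<partial>lborel)
     \<le> (\<integral>\<^sup>+p. ennreal (indicator ({-R..R} \<times> {-R..R}) p * F_minus p) \<partial>lborel)"
    using sub F_minus_nonneg by (intro nn_integral_mono) (auto simp: indicator_def)
  also have "\<dots> \<le> ennreal (2 * R) * ennreal (C_minus * (2 * sqrt R))"
    by (rule nn_integral_F_minus_box) (simp add: R_def)
  also have "\<dots> < \<infinity>"
    by (simp add: ennreal_mult_less_top)
  finally show "set_integrable lborel K F_minus"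
    unfolding set_integrable_def by (intro integrableI_bounded) measurable
qed

section \<open>Comparison of the fundamental solutions with the limit\<close>

lemma E_I_measurable [measurable]: "E_I b \<in> borel_measurable borel"
  unfolding E_I_def D_I_def ell_def em_def mem_Collect_eq prod.case case_prod_beta fst_conv snd_conv
     borel_prod[symmetric]
  by measurable

lemma gauss_argument_bounds:
  fixes l m l0 :: real
  assumes "l0 \<ge> 0" "l > l0" "m < - l0"
  shows "(l - l0) * (m + l0) / ((l + l0) * (m - l0)) \<in> {0..1}"
proof -
  have "(l - l0) * (m + l0) / ((l + l0) * (m - l0))
      = ((l - l0) / (l + l0)) * ((- m - l0) / (- m + l0))"
    using assms by (simp add: divide_simps) algebra
  moreover have "0 \<le> (l - l0) / (l + l0)" "(l - l0) / (l + l0) \<le> 1"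
      "0 \<le> (- m - l0) / (- m + l0)" "(- m - l0) / (- m + l0) \<le> 1"
    using assms by (simp_all add: divide_simps)
  ultimately show ?thesis
    by (simp only: atLeastAtMost_iff) (intro conjI mult_nonneg_nonneg mult_le_one)
qed

text \<open>Both factors of \<open>E_I b\<close> increase when \<open>ell0 b\<close> is replaced by \<open>0\<close> in the powers and the argument
  of the hypergeometric function by \<open>1\<close>; the result is \<open>F_minus\<close>.\<close>

lemma E_I_bounds:
  shows "0 \<le> E_I b p" "E_I b p \<le> F_minus p"
proof -
  obtain x y where p: "p = (x, y)" by (cases p)
  have "0 \<le> E_I b (x, y) \<and> E_I b (x, y) \<le> F_minus (x, y)"
  proof (cases "(x, y) \<in> D_I b")
    case True
    define l m l0 where "l = ell x y" and "m = em x y" and "l0 = ell0 b"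
    have l0: "l0 \<ge> 0" by (simp add: l0_def ell0_def)
    have D: "y < 0" "l > l0" "m < - l0"
      using True by (auto simp: D_I_def l_def m_def l0_def)
    let ?z = "(l - l0) * (m + l0) / ((l + l0) * (m - l0))"
    have z: "0 \<le> ?z" "?z \<le> 1"
      using gauss_argument_bounds[OF l0 D(2,3)] by auto
    have F: "0 \<le> gauss_F (1/6) (1/6) 1 ?z"
        "gauss_F (1/6) (1/6) 1 ?z \<le> gauss_F (1/6) (1/6) 1 1"
      using z by (auto intro!: gauss_F_bounds)
    have E: "E_I b (x, y) = 2 powr (-1/3) * ((l + l0) powr (-1/6) * (l0 - m) powr (-1/6)) *
        gauss_F (1/6) (1/6) 1 ?z"
      using True by (simp add: E_I_def l_def m_def l0_def)
    have lm: "l * m = 9 * x\<^sup>2 + 4 * y ^ 3"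
      using ell_em[OF D(1)] by (simp add: l_def m_def)
    have lm_neg: "l * m < 0"
      using D l0 by (intro mult_pos_neg) auto
    have "(l + l0) powr (-1/6) * (l0 - m) powr (-1/6) \<le> l powr (-1/6) * (- m) powr (-1/6)"
      using D l0 by (intro mult_mono powr_mono2') auto
    also have "\<dots> = (l * (- m)) powr (-1/6)"
      by (rule powr_mult[symmetric])
    also have "l * (- m) = \<bar>9 * x\<^sup>2 + 4 * y ^ 3\<bar>"
      using lm lm_neg by simp
    finally have "E_I b (x, y) \<le> 2 powr (-1/3) * \<bar>9 * x\<^sup>2 + 4 * y ^ 3\<bar> powr (-1/6) *
        gauss_F (1/6) (1/6) 1 1"
      unfolding E using F by (intro mult_mono) auto
    also have "\<dots> = F_minus (x, y)"
      using lm lm_neg by (simp add: F_minus_def C_minus_def powr_minus_divide)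
    finally show ?thesis
      using F by (simp add: E)
  next
    case False
    then show ?thesis
      using F_minus_nonneg by (simp add: E_I_def)
  qed
  then show "0 \<le> E_I b p" "E_I b p \<le> F_minus p"
    by (simp_all add: p)
qed

lemma locally_integrable_E_I: "locally_integrable (E_I b)"
  unfolding locally_integrable_def
proof (intro allI impI)
  fix K :: "(real \<times> real) set"
  assume K: "compact K"
  then have [measurable]: "K \<in> sets borel"
    by (simp add: borel_compact)
  have "integrable lborel (\<lambda>p. indicator K p *\<^sub>R F_minus p)"
    using locally_integrable_F_minus K by (simp add: locally_integrable_def set_integrable_def)
  then show "set_integrable lborel K (E_I b)"
    unfolding set_integrable_def
    by (rule Bochner_Integration.integrable_bound)
       (use E_I_bounds[of b] F_minus_nonneg in \<open>auto simp: indicator_def\<close>)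
qed

text \<open>Where \<open>F_minus\<close> vanishes, the bounds force \<open>E_I b\<close> to vanish too. Any other point lies in
  \<open>D_I b\<close> as soon as \<open>ell0 b < min l (- m)\<close>. One-sided continuity of the hypergeometric function at
  \<open>1\<close> is enough there, because its argument approaches \<open>1\<close> within \<open>[0,1]\<close>.\<close>

lemma E_I_tendsto_F_minus: "((\<lambda>b. E_I b p) \<longlongrightarrow> F_minus p) (at_left 0)"
proof -
  obtain x y where p: "p = (x, y)" by (cases p)
  show ?thesis
  proof (cases "9 * x\<^sup>2 + 4 * y ^ 3 < 0")
    case False
    have "E_I b p = 0" for b
      using E_I_bounds[of b p] False by (simp add: p F_minus_def)
    then show ?thesis
      using False by (simp add: p F_minus_def)
  next
    case True
    define l m where "l = ell x y" and "m = em x y"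
    have lm: "y < 0" "l > 0" "m < 0"
      using True hyperbolic_region by (auto simp: l_def m_def)
    have lim0: "(ell0 \<longlongrightarrow> 0) (at_left 0)"
    proof -
      have "((\<lambda>b::real. - b) \<longlongrightarrow> - 0) (at_left 0)"
        by (intro tendsto_intros)
      moreover have "\<forall>\<^sub>F b::real in at_left 0. 0 \<le> - b"
        by (auto simp: eventually_at_filter)
      ultimately have "((\<lambda>b::real. 2 * (- b) powr (3/2)) \<longlongrightarrow> 2 * (- 0) powr (3/2)) (at_left 0)"
        by (intro tendsto_intros tendsto_powr') auto
      then show ?thesis by (simp add: ell0_def[abs_def])
    qed
    define z where "z b = (l - ell0 b) * (m + ell0 b) / ((l + ell0 b) * (m - ell0 b))" for b
    have small: "\<forall>\<^sub>F b in at_left 0. ell0 b < l \<and> m < - ell0 b"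
      using order_tendstoD(2)[OF lim0, of "min l (- m)"] lm
      by (auto elim!: eventually_mono)
    have evD: "\<forall>\<^sub>F b in at_left 0. (x, y) \<in> D_I b"
      using small
      by (rule eventually_mono) (use lm in \<open>auto simp: D_I_def l_def m_def\<close>)
    have z01: "\<forall>\<^sub>F b in at_left 0. z b \<in> {0..1}"
      using small
    proof eventually_elim
      case (elim b)
      then show ?case
        unfolding z_def by (intro gauss_argument_bounds) (auto simp: ell0_def)
    qed
    have "(z \<longlongrightarrow> (l - 0) * (m + 0) / ((l + 0) * (m - 0))) (at_left 0)"
      unfolding z_def using lm by (intro tendsto_intros lim0) auto
    then have z1: "(z \<longlongrightarrow> 1) (at_left 0)" using lm by simp
    have "((\<lambda>b. gauss_F (1/6) (1/6) 1 (z b)) \<longlongrightarrow> gauss_F (1/6) (1/6) 1 1) (at_left 0)"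
      by (rule continuous_on_tendsto_compose[OF continuous_on_gauss_F z1 _ z01]) auto
    then have "((\<lambda>b. 2 powr (-1/3) * (l + ell0 b) powr (-1/6) * (ell0 b - m) powr (-1/6) *
          gauss_F (1/6) (1/6) 1 (z b)) \<longlongrightarrow>
        2 powr (-1/3) * (l + 0) powr (-1/6) * (0 - m) powr (-1/6) * gauss_F (1/6) (1/6) 1 1) (at_left 0)"
      using lm by (intro tendsto_intros lim0) auto
    also have "2 powr (-1/3) * (l + 0) powr (-1/6) * (0 - m) powr (-1/6) * gauss_F (1/6) (1/6) 1 1
        = F_minus p"
    proof -
      have "l powr (-1/6) * (- m) powr (-1/6) = (l * (- m)) powr (-1/6)"
        by (rule powr_mult[symmetric])
      also have "l * (- m) = \<bar>9 * x\<^sup>2 + 4 * y ^ 3\<bar>"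
        using ell_em[OF lm(1)] True by (simp add: l_def m_def)
      finally show ?thesis
        using True by (simp add: p F_minus_def C_minus_def powr_minus_divide)
    qed
    finally show ?thesis
      by (rule Lim_transform_eventually)
         (use evD in eventually_elim, simp add: p E_I_def z_def l_def m_def)
  qed
qed

section \<open>Convergence in the sense of distributions\<close>

lemma test_function_bound:
  fixes \<phi> :: "'a::euclidean_space \<Rightarrow> complex"
  assumes "test_function \<phi>"
  obtains B K where "compact K" "\<And>p. norm (\<phi> p) \<le> B * indicator K p"
proof -
  define K where "K = closure {x. \<phi> x \<noteq> 0}"
  have K: "compact K" and "C_k 0 \<phi>"
    using assms unfolding test_function_def K_def by blast+
  then have "continuous_on K \<phi>"
    by (auto intro: continuous_on_subset)
  then have "bounded (\<phi> ` K)"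
    using K by (intro compact_imp_bounded compact_continuous_image)
  then obtain B where B: "\<And>p. p \<in> K \<Longrightarrow> norm (\<phi> p) \<le> B"
    by (auto simp: bounded_iff)
  have "\<phi> p = 0" if "p \<notin> K" for p
    using that closure_subset[of "{x. \<phi> x \<noteq> 0}"] by (auto simp: K_def)
  with B have "norm (\<phi> p) \<le> B * indicator K p" for p
    by (cases "p \<in> K") auto
  with K show ?thesis by (rule that)
qed

lemma test_function_measurable:
  assumes "test_function \<phi>"
  shows "\<phi> \<in> borel_measurable borel"
proof -
  have "C_k 0 \<phi>"
    using assms unfolding test_function_def by blast
  then show ?thesis
    by (simp add: borel_measurable_continuous_onI)
qed

lemma integral_E_I_tendsto:
  assumes "test_function \<phi>"
  shows "((\<lambda>b. LINT p|lborel. complex_of_real (E_I b p) * \<phi> p) \<longlongrightarrow>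
           (LINT p|lborel. complex_of_real (F_minus p) * \<phi> p)) (at_left 0)"
proof (rule tendsto_at_left_sequentially[of "-1"])
  fix S :: "nat \<Rightarrow> real"
  assume S: "\<And>n. S n < 0" "S \<longlonglongrightarrow> 0"
  obtain B K where K: "compact K" and B: "\<And>p. norm (\<phi> p) \<le> B * indicator K p"
    using test_function_bound[OF assms] by blast
  note [measurable] = test_function_measurable[OF assms]
  show "(\<lambda>n. LINT p|lborel. complex_of_real (E_I (S n) p) * \<phi> p) \<longlonglongrightarrow>
         (LINT p|lborel. complex_of_real (F_minus p) * \<phi> p)"
  proof (rule integral_dominated_convergence)
    have "integrable lborel (\<lambda>p. indicator K p *\<^sub>R F_minus p)"
      using locally_integrable_F_minus K by (simp add: locally_integrable_def set_integrable_def)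
    then show "integrable lborel (\<lambda>p. B * (indicator K p *\<^sub>R F_minus p))"
      by (rule integrable_mult_right)
    have "filterlim S (at_left 0) sequentially"
      using S by (auto simp: filterlim_at less_imp_neq)
    then have "(\<lambda>n. E_I (S n) p) \<longlonglongrightarrow> F_minus p" for p
      by (rule filterlim_compose[OF E_I_tendsto_F_minus])
    then show "AE p in lborel. (\<lambda>n. complex_of_real (E_I (S n) p) * \<phi> p)
        \<longlonglongrightarrow> complex_of_real (F_minus p) * \<phi> p"
      by (intro AE_I2 tendsto_intros)
    fix n
    have "norm (complex_of_real (E_I (S n) p) * \<phi> p) \<le> B * (indicator K p *\<^sub>R F_minus p)" for p
    proof -
      have "norm (complex_of_real (E_I (S n) p) * \<phi> p) = E_I (S n) p * norm (\<phi> p)"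
        using E_I_bounds(1)[of "S n" p] by (simp add: norm_mult)
      also have "\<dots> \<le> F_minus p * (B * indicator K p)"
        using B E_I_bounds F_minus_nonneg by (intro mult_mono) auto
      finally show ?thesis by (simp add: mult_ac)
    qed
    then show "AE p in lborel. norm (complex_of_real (E_I (S n) p) * \<phi> p)
        \<le> B * (indicator K p *\<^sub>R F_minus p)"
      by (intro AE_I2)
  qed measurable
qed simp

theorem corollary3p1:
  shows "C_minus = 1 / 2 powr (1/3) * (Gamma (2/3) / (Gamma (5/6))^2)
    \<and> (\<forall>b<0. locally_integrable (E_I b))
    \<and> converges_distributionally E_I F_minus (at_left 0)"
proof (intro conjI allI impI)
  show "C_minus = 1 / 2 powr (1/3) * (Gamma (2/3) / (Gamma (5/6))^2)"
    using gauss_summation[of "1/6" "1/6" 1] by (simp add: C_minus_def power2_eq_square)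
  show "locally_integrable (E_I b)" for b
    by (rule locally_integrable_E_I)
  show "converges_distributionally E_I F_minus (at_left 0)"
    unfolding converges_distributionally_def
    using locally_integrable_E_I locally_integrable_F_minus integral_E_I_tendsto by auto
qed

end
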